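(* Let $\mathbb{E}$ be a (finite-dimensional) Euclidean space, let $g\in\Gamma_0(\mathbb{R})$ be increasing and let $\psi\in\Gamma_0(\mathbb{E})$ be such that $$(\mathrm{ri}\,\mathrm{dom}\,g)\cap\psi(\mathrm{ri}\,\mathrm{dom}\,\psi)\ne\emptyset.$$ Let $\bar x\in\mathbb{E}$. Then the following properties hold. (a) $e_1(g\circ\psi)(\bar x)=-\min_{\lambda\ge0}\{g^*(\lambda)+\bar\phi^\psi_{\bar x}(\lambda)\}$. (b) $P_1(g\circ\psi)(\bar x)=P_1(\bar\lambda\cdot\psi)(\bar x)$ for every $\bar\lambda\in\mathrm{argmin}_{\lambda\ge0}\{g^*(\lambda)+\bar\phi^\psi_{\bar x}(\lambda)\}\ne\emptyset$. (c) If $\psi(P_{\mathrm{cl}(\mathrm{dom}\,\psi)}(\bar x))\notin\partial g^*(0)$, then $\mathrm{argmin}_{\lambda\ge0}\{g^*(\lambda)+\bar\phi^\psi_{\bar x}(\lambda)\}\subset\mathbb{R}_{++}$. This is, in particular, the case if $P_{\mathrm{cl}(\mathrm{dom}\,\psi)}(\bar x)\notin\mathrm{dom}\,\psi$.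
   Context: $\Gamma_0(\mathbb{E})$ denotes the closed proper convex functions $\mathbb{E}\to\mathbb{R}\cup\{+\infty\}$. "Increasing" is in the weak sense ($s\le t$ implies $g(s)\le g(t)$). The composition is $(g\circ\psi)(x)=g(\psi(x))$ if $x\in\mathrm{dom}\,\psi$ and $+\infty$ otherwise. For $h\in\Gamma_0(\mathbb{E})$ and $\lambda>0$, $e_\lambda h(x)=\min_u\{h(u)+\frac1{2\lambda}\|x-u\|^2\}$ and $P_\lambda h(x)$ is the unique minimizer. $P_C$, $d_C$ are the Euclidean projection onto and distance to a closed convex set $C$; $g^*$ is the Fenchel conjugate; $\mathrm{ri}$ the relative interior; $\mathbb{R}_{++}=(0,\infty)$. For $\lambda=0$, $0\cdot\psi$ is understood as the indicator function of $\mathrm{cl}(\mathrm{dom}\,\psi)$, so that $P_1(0\cdot\psi)=P_{\mathrm{cl}(\mathrm{dom}\,\psi)}$. The function $\bar\phi^\psi_{\bar x}:\mathbb{R}\to\mathbb{R}\cup\{+\infty\}$ is $$\bar\phi^\psi_{\bar x}(\lambda)=\begin{cases}-\lambda e_\lambda\psi(\bar x)&\lambda>0,\\-\frac12d^2_{\mathrm{cl}(\mathrm{dom}\,\psi)}(\bar x)&\lambda=0,\\-\lambda\psi(P_{\mathrm{cl}(\mathrm{dom}\,\psi)}(\bar x))-\frac12d^2_{\mathrm{cl}(\mathrm{dom}\,\psi)}(\bar x)&\lambda<0.\end{cases}$$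
   Formalization: The equality in (b) and the inclusions in (c) are stated only when g is nonconstant or the projection of x̄ onto cl(dom ψ) lies in dom ψ; otherwise P_1(g∘ψ)(x̄) does not exist and the argmin is {0}. The space E is taken to be nonzero. *)

theory Defs
  imports "HOL-Analysis.Analysis"
begin

definition edom :: "('a \<Rightarrow> ereal) \<Rightarrow> 'a set" where
  "edom f = {x. f x < \<infinity>}"

definition epi :: "('a \<Rightarrow> ereal) \<Rightarrow> ('a \<times> real) set" where
  "epi f = {(x, r). f x \<le> ereal r}"

definition Gamma0 :: "('a::euclidean_space \<Rightarrow> ereal) set" where
  "Gamma0 = {f. closed (epi f) \<and> convex (epi f) \<and> (\<forall>x. f x \<noteq> -\<infinity>) \<and> edom f \<noteq> {}}"

(* Pitfall: for g and psi in Gamma0 with g increasing, the composition may fail to be closed.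
   This happens exactly when g is constant and edom psi is not closed; then it is a constant
   on edom psi and \<infinity> elsewhere, and its proximal point at x need not exist. *)
definition ecomp :: "(real \<Rightarrow> ereal) \<Rightarrow> ('a \<Rightarrow> ereal) \<Rightarrow> 'a \<Rightarrow> ereal" where
  "ecomp g \<psi> x = (if x \<in> edom \<psi> then g (real_of_ereal (\<psi> x)) else \<infinity>)"

definition prox_obj :: "real \<Rightarrow> ('a::euclidean_space \<Rightarrow> ereal) \<Rightarrow> 'a \<Rightarrow> 'a \<Rightarrow> ereal" where
  "prox_obj l h x u = h u + ereal (1 / (2 * l) * (norm (x - u))\<^sup>2)"

definition moreau_env :: "real \<Rightarrow> ('a::euclidean_space \<Rightarrow> ereal) \<Rightarrow> 'a \<Rightarrow> ereal" where
  "moreau_env l h x = (INF u. prox_obj l h x u)"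

definition argmin_on :: "'a set \<Rightarrow> ('a \<Rightarrow> ereal) \<Rightarrow> 'a set" where
  "argmin_on S f = {x. is_arg_min f (\<lambda>y. y \<in> S) x}"

definition prox :: "real \<Rightarrow> ('a::euclidean_space \<Rightarrow> ereal) \<Rightarrow> 'a \<Rightarrow> 'a" where
  "prox l h x = (THE u. u \<in> argmin_on UNIV (prox_obj l h x))"

definition conjugate :: "('a::euclidean_space \<Rightarrow> ereal) \<Rightarrow> 'a \<Rightarrow> ereal" where
  "conjugate f y = (SUP x. ereal (y \<bullet> x) - f x)"

definition subdifferential :: "('a::euclidean_space \<Rightarrow> ereal) \<Rightarrow> 'a \<Rightarrow> 'a set" where
  "subdifferential f x =
     {v. \<bar>f x\<bar> \<noteq> \<infinity> \<and> (\<forall>y. f x + ereal (v \<bullet> (y - x)) \<le> f y)}"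

(* Scalar multiple, with 0 times psi read as the indicator function of closure (edom psi). *)
definition escale :: "real \<Rightarrow> ('a::euclidean_space \<Rightarrow> ereal) \<Rightarrow> 'a \<Rightarrow> ereal" where
  "escale l \<psi> x =
     (if l = 0 then (if x \<in> closure (edom \<psi>) then 0 else \<infinity>) else ereal l * \<psi> x)"

definition phi_bar :: "('a::euclidean_space \<Rightarrow> ereal) \<Rightarrow> 'a \<Rightarrow> real \<Rightarrow> ereal" where
  "phi_bar \<psi> x l =
     (let C = closure (edom \<psi>) in
      if l > 0 then - (ereal l * moreau_env l \<psi> x)
      else if l = 0 then - ereal (1 / 2 * (infdist x C)\<^sup>2)
      else - (ereal l * \<psi> (closest_point C x)) - ereal (1 / 2 * (infdist x C)\<^sup>2))"

end

theory Submission
  imports Defs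
begin

text \<open>
  The proof is Lagrangian duality for the constraint \<open>\<psi> u \<le> t\<close>. For \<open>\<lambda> \<ge> 0\<close> the value
  \<open>- phi_bar \<psi> x \<lambda>\<close> is the infimum over \<open>u\<close> of \<open>\<lambda> \<psi>(u) + |x - u|\<^sup>2 / 2\<close>, that is, the Moreau envelope
  of \<open>\<lambda> \<psi>\<close> at \<open>x\<close>, where \<open>0 \<psi>\<close> is the indicator function of the closure of the domain
  (\<open>phi_bar_eq_moreau_env\<close>). The inequality \<open>g t \<ge> \<lambda> t - g\<^sup>*(\<lambda>)\<close> with \<open>t = \<psi>(u)\<close> then gives
  \<open>- e(x) \<le> g\<^sup>*(\<lambda>) + phi_bar \<psi> x \<lambda>\<close>, where \<open>e\<close> is the envelope of the composition (\<open>weak_duality\<close>).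

  Conversely, let \<open>v = e(x)\<close>. The convex planar sets
  \<open>{(t, r). \<psi>(u) \<le> t \<and> |x - u|\<^sup>2 / 2 \<le> r for some u}\<close> and \<open>{(t, r). g t + r < v}\<close> are disjoint because
  \<open>g\<close> is increasing. A separating line has a normal with nonnegative entries, and it is not
  vertical: some point of the domain of \<open>\<psi>\<close> has its value in the interior of the domain of \<open>g\<close>.
  Its slope is a multiplier that attains equality (\<open>strong_duality\<close>).

  If \<open>w\<close> is a proximal point of the composition and \<open>\<lambda>\<close> is an optimal multiplier, all inequalities of
  weak duality are equalities at \<open>w\<close>, so \<open>w\<close> is the unique proximal point of \<open>\<lambda> \<psi>\<close>
  (\<open>dual_optimal_minimizer\<close>). Such a \<open>w\<close> exists: if \<open>g\<close> is not constant, the composition is closed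
  (\<open>ecomp_Gamma0\<close>), and if \<open>g\<close> is constant, the projection onto the closure of the domain serves
  when it lies in the domain. Finally, if \<open>0\<close> is optimal, then \<open>w\<close> is the projection \<open>p\<close> of \<open>x\<close> onto the closure
  of the domain, and equality reads \<open>g\<^sup>*(0) = - g(\<psi> p)\<close>, which says that \<open>\<psi> p\<close> is a subgradient of \<open>g\<^sup>*\<close> at \<open>0\<close>.
\<close>

section \<open>Closed proper convex functions\<close>

lemma mem_epi: "(u, r) \<in> epi k \<longleftrightarrow> k u \<le> ereal r"
  by (simp add: epi_def)

lemma argmin_on_iff: "u \<in> argmin_on S f \<longleftrightarrow> u \<in> S \<and> (\<forall>y\<in>S. f u \<le> f y)"
  by (auto simp: argmin_on_def is_arg_min_linorder)

lemma edom_finite: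
  assumes "k \<in> Gamma0" "u \<in> edom k"
  shows "k u = ereal (real_of_ereal (k u))"
  using assms by (cases "k u") (auto simp: Gamma0_def edom_def)

lemma edomI: "k u \<le> ereal r \<Longrightarrow> u \<in> edom k"
  by (auto simp: edom_def le_less_trans)

lemma edom_eq_fst_epi:
  assumes "k \<in> Gamma0" shows "edom k = fst ` epi k"
proof
  show "edom k \<subseteq> fst ` epi k"
  proof
    fix u assume "u \<in> edom k"
    then have "(u, real_of_ereal (k u)) \<in> epi k"
      using edom_finite[OF assms, of u] by (metis mem_epi order_refl)
    then show "u \<in> fst ` epi k" by force
  qed
  show "fst ` epi k \<subseteq> edom k" by (auto simp: mem_epi intro: edomI)
qed

lemma convex_edom:
  assumes "k \<in> Gamma0" shows "convex (edom k)"
  using assms unfolding edom_eq_fst_epi[OF assms]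
  by (intro convex_linear_image linear_fst) (auto simp: Gamma0_def)

lemma Gamma0_jensen:
  assumes "k \<in> Gamma0" "k u \<le> ereal r" "k v \<le> ereal s" "0 \<le> a" "0 \<le> b" "a + b = 1"
  shows "k (a *\<^sub>R u + b *\<^sub>R v) \<le> ereal (a * r + b * s)"
proof -
  have "a *\<^sub>R (u, r) + b *\<^sub>R (v, s) \<in> epi k"
    using assms by (intro convexD) (auto simp: Gamma0_def mem_epi)
  then show ?thesis by (simp add: mem_epi)
qed

text \<open>A hyperplane separating the epigraph from a point strictly below it on a vertical line
  through the domain cannot be vertical, so it is the graph of an affine minorant.\<close>

lemma Gamma0_affine_minorant:
  fixes k :: "'a::euclidean_space \<Rightarrow> ereal"
  assumes "k \<in> Gamma0"
  obtains a c where "\<And>u. ereal (a \<bullet> u + c) \<le> k u"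
proof -
  obtain x0 where x0: "x0 \<in> edom k" using assms by (auto simp: Gamma0_def)
  define r0 where "r0 = real_of_ereal (k x0)"
  have r0: "k x0 = ereal r0" using edom_finite[OF assms x0] by (simp add: r0_def)
  have "(x0, r0 - 1) \<notin> epi k" by (simp add: mem_epi r0)
  then obtain z d where z: "z \<bullet> (x0, r0 - 1) < d" "\<And>w. w \<in> epi k \<Longrightarrow> z \<bullet> w > d"
    using separating_hyperplane_closed_point[of "epi k" "(x0, r0 - 1)"] assms
    unfolding Gamma0_def by blast
  obtain a b where ab: "z = (a, b)" by (cases z)
  have "(x0, r0) \<in> epi k" by (simp add: mem_epi r0)
  from z(2)[OF this] z(1) have "b * (r0 - 1) < b * r0" by (simp add: ab)
  then have b: "b > 0" by (simp add: algebra_simps)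
  have "ereal ((- (1/b) *\<^sub>R a) \<bullet> u + d / b) \<le> k u" for u
  proof (cases "u \<in> edom k")
    case True
    then have "(u, real_of_ereal (k u)) \<in> epi k"
      using edom_finite[OF assms True] by (metis mem_epi order_refl)
    from z(2)[OF this] have "d < a \<bullet> u + b * real_of_ereal (k u)" by (simp add: ab)
    with b have "(- (1/b) *\<^sub>R a) \<bullet> u + d / b \<le> real_of_ereal (k u)"
      by (simp add: field_simps)
    then show ?thesis using edom_finite[OF assms True] by (metis ereal_less_eq(3))
  next
    case False
    then show ?thesis by (simp add: edom_def)
  qed
  then show ?thesis by (rule that)
qed

section \<open>Existence and uniqueness of proximal points\<close>

lemma norm_sq_convex_combination:
  fixes p q :: "'a::real_inner"
  assumes "a + b = 1"
  shows "(norm (a *\<^sub>R p + b *\<^sub>R q))\<^sup>2 = a * (norm p)\<^sup>2 + b * (norm q)\<^sup>2 - a * b * (norm (p - q))\<^sup>2"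
proof -
  have b: "b = 1 - a" using assms by simp
  show ?thesis
    unfolding b power2_norm_eq_inner
    by (simp add: inner_simps inner_commute[of q p] algebra_simps power2_eq_square)
qed

lemma diff_convex_combination:
  fixes x :: "'a::real_vector"
  assumes "a + b = 1"
  shows "x - (a *\<^sub>R u + b *\<^sub>R v) = a *\<^sub>R (x - u) + b *\<^sub>R (x - v)"
proof -
  have b: "b = 1 - a" using assms by simp
  show ?thesis unfolding b by (simp add: algebra_simps)
qed

lemma prox_obj_1: "prox_obj 1 k x u = k u + ereal (1/2 * (norm (x - u))\<^sup>2)"
  by (simp add: prox_obj_def)

lemma prox_obj_le_iff:
  "prox_obj 1 k x u \<le> ereal r \<longleftrightarrow> k u \<le> ereal (r - 1/2 * (norm (x - u))\<^sup>2)"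
  by (cases "k u") (auto simp: prox_obj_1)

text \<open>By an affine minorant and completion of the square, each sublevel set of the epigraph of the
  proximal objective is compact, so the height attains its minimum there.\<close>

lemma prox_obj_minimizer_exists:
  fixes k :: "'a::euclidean_space \<Rightarrow> ereal"
  assumes k: "k \<in> Gamma0"
  obtains w where "w \<in> edom k" "\<And>u. prox_obj 1 k x w \<le> prox_obj 1 k x u"
proof -
  obtain a c where ac: "\<And>u. ereal (a \<bullet> u + c) \<le> k u"
    using Gamma0_affine_minorant[OF k] by blast
  obtain x0 where x0: "x0 \<in> edom k" using k by (auto simp: Gamma0_def)
  define r0 where "r0 = real_of_ereal (k x0) + 1/2 * (norm (x - x0))\<^sup>2"
  have r0: "prox_obj 1 k x x0 = ereal r0"
    unfolding prox_obj_1 r0_def by (subst edom_finite[OF k x0]) simp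
  define Q where "Q = {w :: 'a \<times> real. prox_obj 1 k x (fst w) \<le> ereal (snd w) \<and> snd w \<le> r0}"
  define m where "m = a \<bullet> x - 1/2 * (norm a)\<^sup>2 + c"
  have low: "m + 1/2 * (norm (u - (x - a)))\<^sup>2 \<le> r" if "prox_obj 1 k x u \<le> ereal r" for u r
  proof -
    have "ereal (a \<bullet> u + c) \<le> ereal (r - 1/2 * (norm (x - u))\<^sup>2)"
      using ac[of u] that unfolding prox_obj_le_iff by (rule order_trans)
    moreover have "m + 1/2 * (norm (u - (x - a)))\<^sup>2 = a \<bullet> u + c + 1/2 * (norm (x - u))\<^sup>2"
      unfolding m_def power2_norm_eq_inner
      by (simp add: inner_simps inner_commute algebra_simps)
    ultimately show ?thesis by simp
  qed
  have Qeq: "Q = (\<lambda>w. (fst w, snd w - 1/2 * (norm (x - fst w))\<^sup>2)) -` epi k \<inter> snd -` {..r0}"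
    by (auto simp: Q_def prox_obj_le_iff mem_epi)
  have "closed Q"
    unfolding Qeq using k
    by (intro closed_Int closed_vimage) (auto intro!: continuous_intros simp: Gamma0_def)
  moreover have "bounded Q"
  proof (rule bounded_subset)
    show "Q \<subseteq> cball (x - a) (sqrt (2 * (r0 - m))) \<times> {m..r0}"
    proof
      fix w assume w: "w \<in> Q"
      obtain u r where ur: "w = (u, r)" by (cases w)
      have *: "m + 1/2 * (norm (u - (x - a)))\<^sup>2 \<le> r" "r \<le> r0"
        using w low[of u r] by (auto simp: Q_def ur)
      then have "(norm (u - (x - a)))\<^sup>2 \<le> 2 * (r0 - m)" by simp
      then have "norm (u - (x - a)) \<le> sqrt (2 * (r0 - m))" by (rule real_le_rsqrt)
      moreover have "m \<le> r" using *(1) zero_le_power2[of "norm (u - (x - a))"] by linarith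
      ultimately show "w \<in> cball (x - a) (sqrt (2 * (r0 - m))) \<times> {m..r0}"
        using * by (simp add: ur dist_norm norm_minus_commute)
    qed
    show "bounded (cball (x - a) (sqrt (2 * (r0 - m))) \<times> {m..r0})"
      by (intro bounded_Times) auto
  qed
  ultimately have "compact Q" by (simp add: compact_eq_bounded_closed)
  moreover have mem0: "(x0, r0) \<in> Q" by (simp add: Q_def r0)
  ultimately obtain q where q: "q \<in> Q" "\<And>y. y \<in> Q \<Longrightarrow> snd q \<le> snd y"
    using continuous_attains_inf[of Q snd] continuous_on_snd[OF continuous_on_id] by blast
  obtain w r where wr: "q = (w, r)" by (cases q)
  have le: "prox_obj 1 k x w \<le> prox_obj 1 k x u" for u
  proof (rule ccontr)
    assume "\<not> ?thesis"
    then have lt: "prox_obj 1 k x u < prox_obj 1 k x w" by simp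
    also have wle: "prox_obj 1 k x w \<le> ereal r" using q(1) by (simp add: Q_def wr)
    finally have lt': "prox_obj 1 k x u < ereal r" .
    have "prox_obj 1 k x u \<noteq> -\<infinity>" using k by (auto simp: prox_obj_1 Gamma0_def)
    then obtain s where s: "prox_obj 1 k x u = ereal s"
      using lt' by (cases "prox_obj 1 k x u") auto
    have "s < r" using lt' s by simp
    moreover have "r \<le> r0" using q(1) by (simp add: Q_def wr)
    ultimately have "(u, s) \<in> Q" using s by (simp add: Q_def)
    from q(2)[OF this] \<open>s < r\<close> show False by (simp add: wr)
  qed
  moreover have "w \<in> edom k"
    using le[of x0] unfolding r0 prox_obj_le_iff by (rule edomI)
  ultimately show ?thesis using that by blast
qed

lemma prox_obj_minimizer_unique:
  fixes k :: "'a::euclidean_space \<Rightarrow> ereal"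
  assumes k: "k \<in> Gamma0"
    and w: "\<And>u. prox_obj 1 k x w \<le> prox_obj 1 k x u"
    and w': "\<And>u. prox_obj 1 k x w' \<le> prox_obj 1 k x u"
  shows "w = w'"
proof (rule ccontr)
  assume ne: "w \<noteq> w'"
  obtain w0 where w0: "w0 \<in> edom k" "\<And>u. prox_obj 1 k x w0 \<le> prox_obj 1 k x u"
    using prox_obj_minimizer_exists[OF k] by blast
  define m where "m = real_of_ereal (k w0) + 1/2 * (norm (x - w0))\<^sup>2"
  have m0: "prox_obj 1 k x w0 = ereal m"
    unfolding prox_obj_1 m_def by (subst edom_finite[OF k w0(1)]) simp
  have le: "prox_obj 1 k x w \<le> ereal m" "prox_obj 1 k x w' \<le> ereal m"
    using w[of w0] w'[of w0] by (simp_all add: m0)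
  \<comment> \<open>By the parallelogram law the midpoint has a strictly smaller value.\<close>
  define z where "z = (1/2) *\<^sub>R w + (1/2) *\<^sub>R w'"
  define s where "s = m - 1/2 * (norm (x - w))\<^sup>2"
  define t where "t = m - 1/2 * (norm (x - w'))\<^sup>2"
  have "k z \<le> ereal (1/2 * s + 1/2 * t)"
    unfolding z_def using le unfolding prox_obj_le_iff s_def t_def
    by (intro Gamma0_jensen[OF k]) auto
  moreover have "(norm (x - z))\<^sup>2 = 1/2 * (norm (x - w))\<^sup>2 + 1/2 * (norm (x - w'))\<^sup>2 
      - 1/4 * (norm (w - w'))\<^sup>2"
    unfolding z_def
    by (subst diff_convex_combination, simp, subst norm_sq_convex_combination)
      (auto simp: norm_minus_commute)
  then have "1/2 * s + 1/2 * t = m - 1/8 * (norm (w - w'))\<^sup>2 - 1/2 * (norm (x - z))\<^sup>2"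
    unfolding s_def t_def by (simp add: field_simps)
  ultimately have "prox_obj 1 k x z \<le> ereal (m - 1/8 * (norm (w - w'))\<^sup>2)"
    unfolding prox_obj_le_iff by simp
  also have "\<dots> < ereal m" using ne by simp
  also have "ereal m \<le> prox_obj 1 k x z" using w0(2)[of z] by (simp add: m0)
  finally show False by simp
qed

lemma prox_eqI:
  assumes "\<And>u. prox_obj 1 k x w \<le> prox_obj 1 k x u"
    and "\<And>w'. (\<And>u. prox_obj 1 k x w' \<le> prox_obj 1 k x u) \<Longrightarrow> w' = w"
  shows "prox 1 k x = w"
  unfolding prox_def by (rule the_equality) (use assms in \<open>auto simp: argmin_on_iff\<close>)

lemma moreau_env_eq:
  assumes "\<And>u. prox_obj 1 k x w \<le> prox_obj 1 k x u"
  shows "moreau_env 1 k x = prox_obj 1 k x w"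
  unfolding moreau_env_def using assms by (intro INF_eqI) auto

lemma moreau_env_finite:
  fixes k :: "'a::euclidean_space \<Rightarrow> ereal"
  assumes "k \<in> Gamma0"
  shows "\<bar>moreau_env 1 k x\<bar> \<noteq> \<infinity>"
proof -
  obtain w where w: "w \<in> edom k" "\<And>u. prox_obj 1 k x w \<le> prox_obj 1 k x u"
    using prox_obj_minimizer_exists[OF assms] by blast
  have "moreau_env 1 k x = ereal (real_of_ereal (k w) + 1/2 * (norm (x - w))\<^sup>2)"
    unfolding moreau_env_eq[OF w(2)] prox_obj_1 by (subst edom_finite[OF assms w(1)]) simp
  then show ?thesis by simp
qed

section \<open>Nonnegative multiples of a closed proper convex function\<close>

lemma escale_on_edom:
  assumes "\<psi> \<in> Gamma0" "u \<in> edom \<psi>"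
  shows "escale l \<psi> u = ereal (l * real_of_ereal (\<psi> u))"
  using assms(2) closure_subset[of "edom \<psi>"] unfolding escale_def
  by (subst edom_finite[OF assms]) (auto simp: zero_ereal_def)

lemma escale_Gamma0:
  fixes \<psi> :: "'a::euclidean_space \<Rightarrow> ereal"
  assumes \<psi>: "\<psi> \<in> Gamma0" and l: "0 \<le> l"
  shows "escale l \<psi> \<in> Gamma0"
proof -
  have epi: "closed (epi (escale l \<psi>)) \<and> convex (epi (escale l \<psi>)) \<and> (\<forall>u. escale l \<psi> u \<noteq> -\<infinity>)"
  proof (cases "l = 0")
    case True
    then have "epi (escale l \<psi>) = closure (edom \<psi>) \<times> {0..}"
      by (auto simp: epi_def escale_def split: if_splits)
    then show ?thesis
      using True convex_edom[OF \<psi>]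
      by (auto simp: escale_def intro!: closed_Times convex_Times convex_closure)
  next
    case False
    with l have pos: "l > 0" by simp
    have "ereal l * e \<le> ereal r \<longleftrightarrow> e \<le> ereal (r / l)" for e r
      using pos by (cases e) (auto simp: field_simps)
    then have eq: "epi (escale l \<psi>) = (\<lambda>w. (fst w, snd w / l)) -` epi \<psi>"
      using False by (auto simp: epi_def escale_def)
    have "linear (\<lambda>w :: 'a \<times> real. (fst w, snd w / l))"
      by (rule linearI) (auto simp: add_divide_distrib)
    moreover have "escale l \<psi> u \<noteq> -\<infinity>" for u
      using pos \<psi> by (cases "\<psi> u") (auto simp: escale_def Gamma0_def)
    ultimately show ?thesis
      unfolding eq using \<psi> pos
      by (auto simp: Gamma0_def intro!: closed_vimage convex_linear_vimage continuous_intros)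
  qed
  obtain u where u: "u \<in> edom \<psi>" using \<psi> by (auto simp: Gamma0_def)
  then have "u \<in> edom (escale l \<psi>)" using escale_on_edom[OF \<psi> u, of l] by (simp add: edom_def)
  with epi show ?thesis unfolding Gamma0_def by blast
qed

lemma closest_point_minimizes_escale_0:
  assumes "\<psi> \<in> Gamma0"
  shows "prox_obj 1 (escale 0 \<psi>) x (closest_point (closure (edom \<psi>)) x) \<le> prox_obj 1 (escale 0 \<psi>) x u"
proof (cases "u \<in> closure (edom \<psi>)")
  case True
  have "closest_point (closure (edom \<psi>)) x \<in> closure (edom \<psi>)"
    using True by (intro closest_point_in_set) auto
  moreover have "norm (x - closest_point (closure (edom \<psi>)) x) \<le> norm (x - u)"
    using closest_point_le[OF closed_closure True, of x] by (simp add: dist_norm)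
  ultimately show ?thesis
    using True by (simp add: prox_obj_1 escale_def power_mono)
next
  case False
  then show ?thesis by (simp add: prox_obj_1 escale_def)
qed

text \<open>With the indicator convention for the multiplier zero, the cases of a nonnegative parameter in
  the definition of \<^const>\<open>phi_bar\<close> coincide.\<close>

lemma phi_bar_eq_moreau_env:
  fixes \<psi> :: "'a::euclidean_space \<Rightarrow> ereal"
  assumes \<psi>: "\<psi> \<in> Gamma0" and l: "0 \<le> l"
  shows "phi_bar \<psi> x l = - moreau_env 1 (escale l \<psi>) x"
proof (cases "l = 0")
  case True
  let ?C = "closure (edom \<psi>)"
  have ne: "?C \<noteq> {}" using \<psi> by (auto simp: Gamma0_def)
  have inC: "closest_point ?C x \<in> ?C" using ne by (intro closest_point_in_set) auto
  have "infdist x ?C = dist x (closest_point ?C x)"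
  proof (rule antisym)
    show "infdist x ?C \<le> dist x (closest_point ?C x)" by (rule infdist_le[OF inC])
    show "dist x (closest_point ?C x) \<le> infdist x ?C"
      using ne closest_point_le[OF closed_closure]
      by (auto simp: infdist_def intro!: cINF_greatest)
  qed
  then have "moreau_env 1 (escale 0 \<psi>) x = ereal (1/2 * (infdist x ?C)\<^sup>2)"
    unfolding moreau_env_eq[OF closest_point_minimizes_escale_0[OF \<psi>]] using inC
    by (simp add: prox_obj_1 escale_def dist_norm)
  then show ?thesis using True by (simp add: phi_bar_def)
next
  case False
  with l have pos: "l > 0" by simp
  have obj: "ereal l * prox_obj l \<psi> x u = prox_obj 1 (escale l \<psi>) x u" for u
    using pos \<psi> by (cases "\<psi> u") (auto simp: prox_obj_def escale_def Gamma0_def field_simps)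
  have "ereal l * moreau_env l \<psi> x = moreau_env 1 (escale l \<psi>) x"
    using ereal_Inf_cmult[OF pos, of "\<lambda>y. y \<in> range (prox_obj l \<psi> x)"]
    unfolding moreau_env_def obj[symmetric]
    by (simp add: full_SetCompr_eq image_image setcompr_eq_image)
  then show ?thesis using pos by (simp add: phi_bar_def)
qed

section \<open>Increasing functions on the line\<close>

text \<open>An affine function that is bounded below on the nonnegative half-line has nonnegative slope.\<close>

lemma nonneg_slope:
  fixes a \<alpha> \<beta> :: real
  assumes "\<And>n. 0 \<le> n \<Longrightarrow> \<beta> \<le> \<alpha> + a * n"
  shows "0 \<le> a"
proof (rule ccontr)
  assume "\<not> 0 \<le> a"
  then have a: "a < 0" by simp
  define n where "n = max 0 ((\<beta> - \<alpha>) / a + 1)"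
  have "a * n \<le> a * ((\<beta> - \<alpha>) / a + 1)"
    unfolding n_def using a by (intro mult_left_mono_neg) auto
  also have "\<dots> = \<beta> - \<alpha> + a" using a by (simp add: field_simps)
  finally have "\<alpha> + a * n < \<beta>" using a by simp
  moreover have "0 \<le> n" by (simp add: n_def)
  ultimately show False using assms by (meson not_le)
qed

lemma conjugate_not_MInf:
  assumes "g \<in> Gamma0"
  shows "conjugate g l \<noteq> -\<infinity>"
proof -
  obtain s where s: "s \<in> edom g" using assms by (auto simp: Gamma0_def)
  have "ereal (l \<bullet> s) - g s \<le> conjugate g l"
    unfolding conjugate_def by (rule SUP_upper) simp
  moreover have "ereal (l \<bullet> s) - g s \<noteq> -\<infinity>"
    by (subst edom_finite[OF assms s]) simp
  ultimately show ?thesis by auto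
qed

text \<open>The slope of an affine minorant of an increasing function is nonnegative.\<close>

lemma mono_conjugate_finite_somewhere:
  fixes g :: "real \<Rightarrow> ereal"
  assumes g: "g \<in> Gamma0" and "mono g"
  obtains l c where "0 \<le> l" "conjugate g l = ereal c"
proof -
  obtain a c where ac: "\<And>t. ereal (a \<bullet> t + c) \<le> g t"
    using Gamma0_affine_minorant[OF g] by blast
  obtain s where s: "s \<in> edom g" using g by (auto simp: Gamma0_def)
  have "0 \<le> a"
  proof (rule nonneg_slope)
    fix n :: real assume "0 \<le> n"
    then have "g (s - n) \<le> g s" using \<open>mono g\<close> by (intro monoD[OF \<open>mono g\<close>]) auto
    with ac[of "s - n"] have "ereal (a * (s - n) + c) \<le> g s" by simp
    then have "a * (s - n) + c \<le> real_of_ereal (g s)"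
      by (subst (asm) edom_finite[OF g s]) simp
    then show "a * s + c - real_of_ereal (g s) \<le> 0 + a * n" by (simp add: algebra_simps)
  qed
  moreover have "conjugate g a \<le> ereal (- c)"
    unfolding conjugate_def
  proof (rule SUP_least)
    fix t
    show "ereal (a \<bullet> t) - g t \<le> ereal (- c)"
      using ac[of t] by (cases "g t") auto
  qed
  ultimately show ?thesis
    using conjugate_not_MInf[OF g, of a] that by (cases "conjugate g a") auto
qed

lemma mono_nonconstant_bounded_sublevel:
  fixes g :: "real \<Rightarrow> ereal"
  assumes g: "g \<in> Gamma0" and mono: "mono g" and ne: "g s \<noteq> g t"
  obtains T where "\<And>y. g y \<le> ereal r \<Longrightarrow> y \<le> T"
proof -
  obtain p q where pq: "p < q" "g p < g q"
    using ne monoD[OF mono, of s t] monoD[OF mono, of t s]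
    by (metis linorder_neqE_linordered_idom less_imp_le order_less_le)
  have p: "p \<in> edom g" using pq(2) by (auto simp: edom_def intro: less_le_trans)
  define gp where "gp = real_of_ereal (g p)"
  have gp: "g p = ereal gp" using edom_finite[OF g p] by (simp add: gp_def)
  show ?thesis
  proof (cases "g q = \<infinity>")
    case True
    have "y \<le> q" if "g y \<le> ereal r" for y
    proof (rule ccontr)
      assume "\<not> y \<le> q"
      then have "g q \<le> g y" by (intro monoD[OF mono]) auto
      with that True show False by auto
    qed
    then show ?thesis by (rule that)
  next
    case False
    then have q: "q \<in> edom g" by (simp add: edom_def less_top[symmetric] top_ereal_def)
    define gq where "gq = real_of_ereal (g q)"
    have gq: "g q = ereal gq" using edom_finite[OF g q] by (simp add: gq_def)
    have lt: "gp < gq" using pq(2) by (simp add: gp gq)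
    \<comment> \<open>Convexity forces \<open>g\<close> to grow beyond \<open>q\<close> at least as fast as its chord from \<open>p\<close> to \<open>q\<close>.\<close>
    have "y \<le> max q (q + (q - p) * (r - gq) / (gq - gp))" if y: "g y \<le> ereal r" for y
    proof (cases "y \<le> q")
      case False
      then have yp: "y - p > 0" using pq(1) by simp
      define a where "a = (y - q) / (y - p)"
      define b where "b = (q - p) / (y - p)"
      have ab: "0 \<le> a" "0 \<le> b" "a + b = 1"
        using False pq(1) yp by (auto simp: a_def b_def simp flip: add_divide_distrib)
      have mult: "a * (y - p) = y - q" "b * (y - p) = q - p"
        using yp by (simp_all add: a_def b_def)
      have "(a * p + b * y) * (y - p) = p * (a * (y - p)) + y * (b * (y - p))"
        by (simp add: algebra_simps)
      also have "\<dots> = q * (y - p)" unfolding mult by (simp add: algebra_simps)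
      finally have "a * p + b * y = q" using yp by simp
      then have "gq \<le> a * gp + b * r"
        using Gamma0_jensen[OF g _ y ab, of p gp] by (simp add: gp gq)
      then have "gq * (y - p) \<le> (a * gp + b * r) * (y - p)"
        using yp by (intro mult_right_mono) auto
      also have "\<dots> = (a * (y - p)) * gp + (b * (y - p)) * r" by (simp add: algebra_simps)
      also have "\<dots> = (y - q) * gp + (q - p) * r" unfolding mult ..
      finally have "(y - q) * (gq - gp) \<le> (q - p) * (r - gq)" by (simp add: algebra_simps)
      then have "y - q \<le> (q - p) * (r - gq) / (gq - gp)" using lt by (simp add: pos_le_divide_eq)
      then show ?thesis by simp
    qed simp
    then show ?thesis by (rule that)
  qed
qed

text \<open>The domain of an increasing function is unbounded below, so its relative interior is
  its interior.\<close>

lemma mono_edom_beyond_rel_interior: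
  fixes g :: "real \<Rightarrow> ereal"
  assumes g: "g \<in> Gamma0" and mono: "mono g" and s: "s \<in> rel_interior (edom g)"
  obtains t where "s < t" "t \<in> edom g"
proof -
  have sd: "s \<in> edom g" using s rel_interior_subset by blast
  have "g (s - 1) \<le> g s" by (intro monoD[OF mono]) simp
  then have "s - 1 \<in> edom g" using sd by (auto simp: edom_def intro: le_less_trans)
  then have "s - 1 \<in> affine hull (edom g)" by (rule hull_inc)
  then obtain m where m: "m > 1" "\<And>e. e > 1 \<and> e \<le> m \<Longrightarrow> (1 - e) *\<^sub>R (s - 1) + e *\<^sub>R s \<in> edom g"
    using convex_rel_interior_if[OF convex_edom[OF g] s] by blast
  have "(1 - m) *\<^sub>R (s - 1) + m *\<^sub>R s = s + (m - 1)" by (simp add: algebra_simps)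
  with m(2)[of m] m(1) show ?thesis by (intro that[of "s + (m - 1)"]) auto
qed

section \<open>The composition\<close>

text \<open>Since \<open>g\<close> is increasing, the epigraph of the composition is the projection, along \<open>t\<close>, of a closed
  convex set of triples \<open>(u, t, r)\<close>.\<close>

lemma ecomp_le_iff:
  fixes g :: "real \<Rightarrow> ereal" and \<psi> :: "'a::euclidean_space \<Rightarrow> ereal"
  assumes mono: "mono g" and \<psi>: "\<psi> \<in> Gamma0"
  shows "ecomp g \<psi> u \<le> ereal r \<longleftrightarrow> (\<exists>t. \<psi> u \<le> ereal t \<and> g t \<le> ereal r)"
proof
  assume L: "ecomp g \<psi> u \<le> ereal r"
  then have u: "u \<in> edom \<psi>" by (auto simp: ecomp_def split: if_splits)
  then have "g (real_of_ereal (\<psi> u)) \<le> ereal r" using L by (simp add: ecomp_def)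
  moreover have "\<psi> u \<le> ereal (real_of_ereal (\<psi> u))" using edom_finite[OF \<psi> u] by simp
  ultimately show "\<exists>t. \<psi> u \<le> ereal t \<and> g t \<le> ereal r" by blast
next
  assume "\<exists>t. \<psi> u \<le> ereal t \<and> g t \<le> ereal r"
  then obtain t where t: "\<psi> u \<le> ereal t" "g t \<le> ereal r" by blast
  have u: "u \<in> edom \<psi>" using t(1) by (rule edomI)
  have "real_of_ereal (\<psi> u) \<le> t" using t(1) by (subst (asm) edom_finite[OF \<psi> u]) simp
  then have "g (real_of_ereal (\<psi> u)) \<le> g t" by (rule monoD[OF mono])
  with t(2) u show "ecomp g \<psi> u \<le> ereal r" by (simp add: ecomp_def)
qed

text \<open>Closedness survives the projection because the eliminated variable \<open>t\<close> stays bounded along a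
  convergent sequence: above by the bounded sublevel sets of the nonconstant function \<open>g\<close>, below by
  an affine minorant of \<open>\<psi>\<close>.\<close>

lemma ecomp_Gamma0:
  fixes g :: "real \<Rightarrow> ereal" and \<psi> :: "'a::euclidean_space \<Rightarrow> ereal"
  assumes g: "g \<in> Gamma0" and mono: "mono g" and \<psi>: "\<psi> \<in> Gamma0" and ne: "g s \<noteq> g t"
    and dom: "edom (ecomp g \<psi>) \<noteq> {}"
  shows "ecomp g \<psi> \<in> Gamma0"
proof -
  note iff = ecomp_le_iff[OF mono \<psi>]
  have "convex (epi (ecomp g \<psi>))"
  proof (rule convexI)
    fix z w :: "'a \<times> real" and a b :: real
    assume "z \<in> epi (ecomp g \<psi>)" "w \<in> epi (ecomp g \<psi>)" and ab: "0 \<le> a" "0 \<le> b" "a + b = 1"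
    then obtain t1 t2 where t1: "\<psi> (fst z) \<le> ereal t1" "g t1 \<le> ereal (snd z)"
      and t2: "\<psi> (fst w) \<le> ereal t2" "g t2 \<le> ereal (snd w)"
      by (cases z, cases w) (auto simp: mem_epi iff)
    have "\<psi> (a *\<^sub>R fst z + b *\<^sub>R fst w) \<le> ereal (a * t1 + b * t2)"
      "g (a * t1 + b * t2) \<le> ereal (a * snd z + b * snd w)"
      using Gamma0_jensen[OF \<psi> t1(1) t2(1) ab] Gamma0_jensen[OF g t1(2) t2(2) ab] by auto
    then show "a *\<^sub>R z + b *\<^sub>R w \<in> epi (ecomp g \<psi>)"
      by (cases z, cases w) (auto simp: mem_epi iff)
  qed
  moreover have "closed (epi (ecomp g \<psi>))"
    unfolding closed_sequential_limits
  proof (intro allI impI, elim conjE)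
    fix f :: "nat \<Rightarrow> 'a \<times> real" and z
    assume f: "\<forall>n. f n \<in> epi (ecomp g \<psi>)" and lim: "f \<longlonglongrightarrow> z"
    have "\<exists>t. \<psi> (fst (f n)) \<le> ereal t \<and> g t \<le> ereal (snd (f n))" for n
      using f by (metis iff mem_epi prod.collapse)
    then obtain \<tau> where \<tau>: "\<And>n. \<psi> (fst (f n)) \<le> ereal (\<tau> n)" "\<And>n. g (\<tau> n) \<le> ereal (snd (f n))"
      by metis
    obtain B where B: "\<And>n. norm (f n) \<le> B"
      using convergent_imp_bounded[OF lim] by (auto simp: bounded_iff)
    obtain T where T: "\<And>y. g y \<le> ereal B \<Longrightarrow> y \<le> T"
      using mono_nonconstant_bounded_sublevel[OF g mono ne] by blast
    obtain a c where ac: "\<And>u. ereal (a \<bullet> u + c) \<le> \<psi> u"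
      using Gamma0_affine_minorant[OF \<psi>] by blast
    have up: "\<tau> n \<le> T" for n
    proof (rule T)
      have "snd (f n) \<le> B" using norm_snd_le[of "snd (f n)" "fst (f n)"] B[of n] by simp
      then show "g (\<tau> n) \<le> ereal B" using \<tau>(2)[of n] by (meson ereal_less_eq(3) order_trans)
    qed
    have low: "c - norm a * B \<le> \<tau> n" for n
    proof -
      have "norm (fst (f n)) \<le> B" using norm_fst_le[of "fst (f n)" "snd (f n)"] B[of n] by simp
      then have "norm a * norm (fst (f n)) \<le> norm a * B" by (intro mult_left_mono) auto
      moreover have "- (a \<bullet> fst (f n)) \<le> norm a * norm (fst (f n))"
        using norm_cauchy_schwarz[of "- a" "fst (f n)"] by simp
      moreover have "a \<bullet> fst (f n) + c \<le> \<tau> n"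
        using order_trans[OF ac \<tau>(1)[of n]] by simp
      ultimately show ?thesis by linarith
    qed
    have "bounded (range \<tau>)"
      by (rule bounded_subset[of "{c - norm a * B..T}"]) (use up low in auto)
    then obtain t r where r: "strict_mono (r :: nat \<Rightarrow> nat)" "(\<tau> \<circ> r) \<longlonglongrightarrow> t"
      using bounded_imp_convergent_subsequence by blast
    have fr: "(\<lambda>n. f (r n)) \<longlonglongrightarrow> z"
      using LIMSEQ_subseq_LIMSEQ[OF lim r(1)] by (simp add: o_def)
    have tr: "(\<lambda>n. \<tau> (r n)) \<longlonglongrightarrow> t" using r(2) by (simp add: o_def)
    have "(fst z, t) \<in> epi \<psi>"
    proof (rule closed_sequentially)
      show "closed (epi \<psi>)" using \<psi> by (simp add: Gamma0_def)
      show "(\<lambda>n. (fst (f (r n)), \<tau> (r n))) \<longlonglongrightarrow> (fst z, t)"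
        by (intro tendsto_intros fr tr)
      show "(fst (f (r n)), \<tau> (r n)) \<in> epi \<psi>" for n using \<tau>(1) by (simp add: mem_epi)
    qed
    moreover have "(t, snd z) \<in> epi g"
    proof (rule closed_sequentially)
      show "closed (epi g)" using g by (simp add: Gamma0_def)
      show "(\<lambda>n. (\<tau> (r n), snd (f (r n)))) \<longlonglongrightarrow> (t, snd z)"
        by (intro tendsto_intros fr tr)
      show "(\<tau> (r n), snd (f (r n))) \<in> epi g" for n using \<tau>(2) by (simp add: mem_epi)
    qed
    ultimately show "z \<in> epi (ecomp g \<psi>)" by (cases z) (auto simp: mem_epi iff)
  qed
  moreover have "ecomp g \<psi> u \<noteq> -\<infinity>" for u using g by (simp add: ecomp_def Gamma0_def)
  ultimately show ?thesis using dom by (simp add: Gamma0_def)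
qed

text \<open>A constant \<open>g\<close> makes the composition a constant plus the indicator function of the possibly
  nonclosed domain of \<open>\<psi>\<close>; it has a proximal point at \<open>x\<close> when the projection of \<open>x\<close> lies in that domain.\<close>

lemma ecomp_prox_obj_minimizer_exists:
  fixes g :: "real \<Rightarrow> ereal" and \<psi> :: "'a::euclidean_space \<Rightarrow> ereal"
  assumes g: "g \<in> Gamma0" and mono: "mono g" and \<psi>: "\<psi> \<in> Gamma0"
    and dom: "edom (ecomp g \<psi>) \<noteq> {}"
    and cases: "(\<exists>s t. g s \<noteq> g t) \<or> closest_point (closure (edom \<psi>)) x \<in> edom \<psi>"
  obtains w where "w \<in> edom \<psi>"
    "\<And>u. prox_obj 1 (ecomp g \<psi>) x w \<le> prox_obj 1 (ecomp g \<psi>) x u"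
proof (cases "\<exists>s t. g s \<noteq> g t")
  case True
  then have "ecomp g \<psi> \<in> Gamma0" using ecomp_Gamma0[OF g mono \<psi> _ dom] by blast
  then obtain w where w: "w \<in> edom (ecomp g \<psi>)"
    "\<And>u. prox_obj 1 (ecomp g \<psi>) x w \<le> prox_obj 1 (ecomp g \<psi>) x u"
    using prox_obj_minimizer_exists by blast
  then have "w \<in> edom \<psi>" by (auto simp: edom_def ecomp_def split: if_splits)
  with w(2) that show ?thesis by blast
next
  case False
  let ?p = "closest_point (closure (edom \<psi>)) x"
  have p: "?p \<in> edom \<psi>" using cases False by blast
  have "prox_obj 1 (ecomp g \<psi>) x ?p \<le> prox_obj 1 (ecomp g \<psi>) x u" for u
  proof (cases "u \<in> edom \<psi>")
    case True
    then have "norm (x - ?p) \<le> norm (x - u)"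
      using closest_point_le[OF closed_closure, of u "edom \<psi>" x] closure_subset[of "edom \<psi>"]
      by (auto simp: dist_norm)
    moreover have "g (real_of_ereal (\<psi> ?p)) = g (real_of_ereal (\<psi> u))" using False by blast
    ultimately show ?thesis
      using True p by (auto simp: prox_obj_1 ecomp_def intro!: add_left_mono power_mono)
  next
    case False
    then show ?thesis by (simp add: prox_obj_1 ecomp_def)
  qed
  with p that show ?thesis by blast
qed

section \<open>Duality\<close>

text \<open>The pointwise form of weak duality: the Fenchel--Young inequality at \<open>t = \<psi> u\<close>.\<close>

lemma prox_obj_escale_le_ecomp:
  fixes g :: "real \<Rightarrow> ereal" and \<psi> :: "'a::euclidean_space \<Rightarrow> ereal"
  assumes \<psi>: "\<psi> \<in> Gamma0" and c: "conjugate g l = ereal c"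
  shows "prox_obj 1 (escale l \<psi>) x u \<le> prox_obj 1 (ecomp g \<psi>) x u + ereal c"
proof (cases "u \<in> edom \<psi>")
  case True
  let ?t = "real_of_ereal (\<psi> u)"
  have "ereal (l \<bullet> ?t) - g ?t \<le> conjugate g l"
    unfolding conjugate_def by (rule SUP_upper) simp
  then have *: "ereal (l * ?t) - g ?t \<le> ereal c" by (simp add: c)
  then show ?thesis
    unfolding prox_obj_1 escale_on_edom[OF \<psi> True] ecomp_def using True
    by (cases "g ?t") auto
next
  case False
  then show ?thesis by (simp add: prox_obj_1 ecomp_def)
qed

lemma weak_duality:
  fixes g :: "real \<Rightarrow> ereal" and \<psi> :: "'a::euclidean_space \<Rightarrow> ereal"
  assumes g: "g \<in> Gamma0" and \<psi>: "\<psi> \<in> Gamma0" and l: "0 \<le> l"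
  shows "- moreau_env 1 (ecomp g \<psi>) x \<le> conjugate g l + phi_bar \<psi> x l"
proof -
  obtain m where m: "moreau_env 1 (escale l \<psi>) x = ereal m"
    using moreau_env_finite[OF escale_Gamma0[OF \<psi> l], of x] by auto
  show ?thesis
  proof (cases "conjugate g l")
    case (real c)
    have "ereal (m - c) \<le> moreau_env 1 (ecomp g \<psi>) x"
      unfolding moreau_env_def
    proof (rule INF_greatest)
      fix u
      have "ereal m \<le> prox_obj 1 (escale l \<psi>) x u"
        unfolding m[symmetric] moreau_env_def by (rule INF_lower) simp
      also have "\<dots> \<le> prox_obj 1 (ecomp g \<psi>) x u + ereal c"
        by (rule prox_obj_escale_le_ecomp[OF \<psi> real])
      finally show "ereal (m - c) \<le> prox_obj 1 (ecomp g \<psi>) x u"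
        by (cases "prox_obj 1 (ecomp g \<psi>) x u") auto
    qed
    then show ?thesis
      unfolding phi_bar_eq_moreau_env[OF \<psi> l] m real
      by (cases "moreau_env 1 (ecomp g \<psi>) x") auto
  qed (use conjugate_not_MInf[OF g] m phi_bar_eq_moreau_env[OF \<psi> l] in auto)
qed

lemma moreau_env_ecomp_finite:
  fixes g :: "real \<Rightarrow> ereal" and \<psi> :: "'a::euclidean_space \<Rightarrow> ereal"
  assumes g: "g \<in> Gamma0" and mono: "mono g" and \<psi>: "\<psi> \<in> Gamma0"
    and dom: "edom (ecomp g \<psi>) \<noteq> {}"
  obtains v where "moreau_env 1 (ecomp g \<psi>) x = ereal v"
proof -
  obtain l c where l: "0 \<le> l" and c: "conjugate g l = ereal c"
    using mono_conjugate_finite_somewhere[OF g mono] by blast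
  have "- moreau_env 1 (ecomp g \<psi>) x < \<infinity>"
    using weak_duality[OF g \<psi> l, of x] moreau_env_finite[OF escale_Gamma0[OF \<psi> l], of x]
    unfolding phi_bar_eq_moreau_env[OF \<psi> l] c by (auto simp: less_top[symmetric] top_ereal_def)
  moreover obtain u where "ecomp g \<psi> u < \<infinity>" using dom by (auto simp: edom_def)
  then have "moreau_env 1 (ecomp g \<psi>) x < \<infinity>"
    unfolding moreau_env_def INF_less_iff by (intro bexI[of _ u]) (auto simp: prox_obj_1)
  ultimately show ?thesis using that by (cases "moreau_env 1 (ecomp g \<psi>) x") auto
qed

text \<open>The supremum of the dual problem equals the envelope and is attained.\<close>

lemma strong_duality:
  fixes g :: "real \<Rightarrow> ereal" and \<psi> :: "'a::euclidean_space \<Rightarrow> ereal"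
  assumes g: "g \<in> Gamma0" and mono: "mono g" and \<psi>: "\<psi> \<in> Gamma0"
    and s0: "\<psi> x0 = ereal s0" "s0 \<in> rel_interior (edom g)"
  obtains l where "0 \<le> l" "conjugate g l + phi_bar \<psi> x l \<le> - moreau_env 1 (ecomp g \<psi>) x"
proof -
  have s0d: "s0 \<in> edom g" using s0(2) rel_interior_subset by blast
  have x0: "x0 \<in> edom \<psi>" using s0(1) by (simp add: edom_def)
  then have "x0 \<in> edom (ecomp g \<psi>)" using s0d s0(1) by (simp add: edom_def ecomp_def)
  then have dom: "edom (ecomp g \<psi>) \<noteq> {}" by blast
  obtain v where v: "moreau_env 1 (ecomp g \<psi>) x = ereal v"
    using moreau_env_ecomp_finite[OF g mono \<psi> dom] by blast
  define K where "K = {(t, r). \<exists>u. \<psi> u \<le> ereal t \<and> 1/2 * (norm (x - u))\<^sup>2 \<le> r}"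
  define L where "L = {(t, r). \<exists>q. g t \<le> ereal q \<and> q + r < v}"
  have KI: "(t, r) \<in> K" if "\<psi> u \<le> ereal t" "1/2 * (norm (x - u))\<^sup>2 \<le> r" for u t r
    using that by (auto simp: K_def)
  have LI: "(t, r) \<in> L" if "g t \<le> ereal q" "q + r < v" for t q r
    using that by (auto simp: L_def)
  have "convex K"
  proof (rule convexI)
    fix z w and a b :: real
    assume "z \<in> K" "w \<in> K" and ab: "0 \<le> a" "0 \<le> b" "a + b = 1"
    then obtain u1 u2 where u1: "\<psi> u1 \<le> ereal (fst z)" "1/2 * (norm (x - u1))\<^sup>2 \<le> snd z"
      and u2: "\<psi> u2 \<le> ereal (fst w)" "1/2 * (norm (x - u2))\<^sup>2 \<le> snd w"
      by (auto simp: K_def)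
    have "\<psi> (a *\<^sub>R u1 + b *\<^sub>R u2) \<le> ereal (a * fst z + b * fst w)"
      by (rule Gamma0_jensen[OF \<psi> u1(1) u2(1) ab])
    moreover have "(norm (x - (a *\<^sub>R u1 + b *\<^sub>R u2)))\<^sup>2 \<le> a * (norm (x - u1))\<^sup>2 + b * (norm (x - u2))\<^sup>2"
      unfolding diff_convex_combination[OF ab(3)] norm_sq_convex_combination[OF ab(3)]
      using ab by simp
    then have "1/2 * (norm (x - (a *\<^sub>R u1 + b *\<^sub>R u2)))\<^sup>2 \<le> a * snd z + b * snd w"
      using mult_left_mono[OF u1(2) ab(1)] mult_left_mono[OF u2(2) ab(2)] by simp
    ultimately show "a *\<^sub>R z + b *\<^sub>R w \<in> K"
      by (cases z, cases w) (auto intro: KI)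
  qed
  moreover have "convex L"
  proof (rule convexI)
    fix z w and a b :: real
    assume "z \<in> L" "w \<in> L" and ab: "0 \<le> a" "0 \<le> b" "a + b = 1"
    then obtain q1 q2 where q1: "g (fst z) \<le> ereal q1" "q1 + snd z < v"
      and q2: "g (fst w) \<le> ereal q2" "q2 + snd w < v"
      by (auto simp: L_def)
    have "g (a * fst z + b * fst w) \<le> ereal (a * q1 + b * q2)"
      using Gamma0_jensen[OF g q1(1) q2(1) ab] by simp
    moreover have "a * (q1 + snd z) + b * (q2 + snd w) < v"
      using ab q1(2) q2(2) by (intro convex_bound_lt) auto
    then have "(a * q1 + b * q2) + (a * snd z + b * snd w) < v" by (simp add: algebra_simps)
    ultimately show "a *\<^sub>R z + b *\<^sub>R w \<in> L"
      by (cases z, cases w) (auto intro: LI)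
  qed
  moreover have K0: "(s0 + n, 1/2 * (norm (x - x0))\<^sup>2 + m) \<in> K" if "0 \<le> n" "0 \<le> m" for n m
    using that s0(1) by (intro KI[of x0]) auto
  then have "K \<noteq> {}" by blast
  moreover have L0: "(t, v - real_of_ereal (g t) - e) \<in> L" if "t \<in> edom g" "e > 0" for t e
    using that edom_finite[OF g that(1)] by (intro LI[of _ "real_of_ereal (g t)"]) auto
  then have "L \<noteq> {}" using s0d zero_less_one by blast
  moreover have "L \<inter> K = {}"
  proof -
    have False if u: "\<psi> u \<le> ereal t" "1/2 * (norm (x - u))\<^sup>2 \<le> r" "g t \<le> ereal q" "q + r < v"
      for u t r q
    proof -
      have "ecomp g \<psi> u \<le> ereal q" using u(1,3) ecomp_le_iff[OF mono \<psi>] by blast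
      also have "ereal q \<le> ereal (q + r - 1/2 * (norm (x - u))\<^sup>2)" using u(2) by simp
      finally have "prox_obj 1 (ecomp g \<psi>) x u \<le> ereal (q + r)" by (simp add: prox_obj_le_iff)
      moreover have "ereal v \<le> prox_obj 1 (ecomp g \<psi>) x u"
        unfolding v[symmetric] moreau_env_def by (rule INF_lower) simp
      ultimately have "ereal v \<le> ereal (q + r)" by (rule order_trans[rotated])
      with u(4) show False by simp
    qed
    then show ?thesis by (auto simp: K_def L_def)
  qed
  \<comment> \<open>\<open>L\<close> and \<open>K\<close> are convex, nonempty and disjoint.\<close>
  ultimately obtain z \<beta> where z: "z \<noteq> 0" "\<forall>y\<in>L. z \<bullet> y \<le> \<beta>" "\<forall>y\<in>K. z \<bullet> y \<ge> \<beta>"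
    using separating_hyperplane_sets[of L K] by blast
  obtain a b where ab: "z = (a, b)" by (cases z)
  have onL: "a * t + b * r \<le> \<beta>" if "(t, r) \<in> L" for t r using z(2) that by (force simp: ab)
  have onK: "\<beta> \<le> a * t + b * r" if "(t, r) \<in> K" for t r using z(3) that by (force simp: ab)
  define r0 where "r0 = 1/2 * (norm (x - x0))\<^sup>2"
  \<comment> \<open>\<open>K\<close> is closed under increasing either coordinate.\<close>
  have a: "0 \<le> a"
  proof (rule nonneg_slope)
    fix n :: real assume "0 \<le> n"
    then show "\<beta> \<le> (a * s0 + b * r0) + a * n"
      using onK[OF K0[of n 0]] by (simp add: r0_def algebra_simps)
  qed
  have "0 \<le> b"
  proof (rule nonneg_slope)
    fix n :: real assume "0 \<le> n"
    then show "\<beta> \<le> (a * s0 + b * r0) + b * n"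
      using onK[OF K0[of 0 n]] by (simp add: r0_def algebra_simps)
  qed
  moreover have "b \<noteq> 0"
  proof
    assume b: "b = 0"
    then have "a > 0" using a z(1) by (auto simp: ab zero_prod_def)
    obtain s1 where s1: "s0 < s1" "s1 \<in> edom g"
      using mono_edom_beyond_rel_interior[OF g mono s0(2)] by blast
    have "a * s1 \<le> \<beta>" using onL[OF L0[OF s1(2), of 1]] b by simp
    also have "\<beta> \<le> a * s0" using onK[OF K0[of 0 0]] b by simp
    finally show False using \<open>a > 0\<close> s1(1) by simp
  qed
  ultimately have b: "b > 0" by simp
  define l where "l = a / b"
  define c where "c = \<beta> / b"
  have l0: "0 \<le> l" using a b by (simp add: l_def)
  have scale: "l * t + r = (a * t + b * r) / b" for t r using b by (simp add: l_def field_simps)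
  have onL': "l * t + r \<le> c" if "(t, r) \<in> L" for t r
    unfolding scale c_def using onL[OF that] b by (simp add: divide_right_mono)
  have onK': "c \<le> l * t + r" if "(t, r) \<in> K" for t r
    unfolding scale c_def using onK[OF that] b by (simp add: divide_right_mono)
  have "conjugate g l \<le> ereal (c - v)"
    unfolding conjugate_def
  proof (rule SUP_least)
    fix t
    show "ereal (l \<bullet> t) - g t \<le> ereal (c - v)"
    proof (cases "t \<in> edom g")
      case True
      \<comment> \<open>\<open>L\<close> is defined by a strict inequality, so its boundary is reached only in the limit.\<close>
      have "l * t - real_of_ereal (g t) \<le> (c - v) + e" if "e > 0" for e
        using onL'[OF L0[OF True that]] by simp
      then have "l * t - real_of_ereal (g t) \<le> c - v" by (rule field_le_epsilon)
      then show ?thesis by (subst edom_finite[OF g True]) simp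
    next
      case False
      then show ?thesis by (simp add: edom_def)
    qed
  qed
  moreover have "ereal c \<le> moreau_env 1 (escale l \<psi>) x"
    unfolding moreau_env_def
  proof (rule INF_greatest)
    fix u
    have ed: "c \<le> l * real_of_ereal (\<psi> w) + 1/2 * (norm (x - w))\<^sup>2" if "w \<in> edom \<psi>" for w
      using edom_finite[OF \<psi> that] by (intro onK' KI[of w]) auto
    consider "u \<in> edom \<psi>" | "l = 0" "u \<in> closure (edom \<psi>)" 
      | "u \<notin> edom \<psi>" "l = 0 \<longrightarrow> u \<notin> closure (edom \<psi>)"
      by blast
    then show "ereal c \<le> prox_obj 1 (escale l \<psi>) x u"
    proof cases
      case 1
      then show ?thesis using ed[OF 1] by (simp add: prox_obj_1 escale_on_edom[OF \<psi>])
    next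
      case 2
      \<comment> \<open>For the multiplier zero the bound extends from the domain to its closure by continuity.\<close>
      have "closure (edom \<psi>) \<subseteq> {w. c \<le> 1/2 * (norm (x - w))\<^sup>2}"
        using ed 2(1) by (intro closure_minimal closed_Collect_le continuous_intros) auto
      then show ?thesis using 2 by (auto simp: prox_obj_1 escale_def)
    next
      case 3
      then show ?thesis using l0 by (auto simp: prox_obj_1 escale_def edom_def)
    qed
  qed
  ultimately have "conjugate g l + phi_bar \<psi> x l \<le> - ereal v"
    unfolding phi_bar_eq_moreau_env[OF \<psi> l0]
    using moreau_env_finite[OF escale_Gamma0[OF \<psi> l0], of x] conjugate_not_MInf[OF g, of l]
    by (cases "conjugate g l"; cases "moreau_env 1 (escale l \<psi>) x") auto
  with l0 v that show ?thesis by metis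
qed

lemma dual_optimal_minimizer:
  fixes g :: "real \<Rightarrow> ereal" and \<psi> :: "'a::euclidean_space \<Rightarrow> ereal"
  assumes \<psi>: "\<psi> \<in> Gamma0" and l: "0 \<le> l"
    and opt: "conjugate g l + phi_bar \<psi> x l = - moreau_env 1 (ecomp g \<psi>) x"
    and fin: "moreau_env 1 (ecomp g \<psi>) x = ereal v"
    and w: "\<And>u. prox_obj 1 (ecomp g \<psi>) x w \<le> prox_obj 1 (ecomp g \<psi>) x u"
  shows "prox_obj 1 (escale l \<psi>) x w \<le> prox_obj 1 (escale l \<psi>) x u"
proof -
  obtain m where m: "moreau_env 1 (escale l \<psi>) x = ereal m"
    using moreau_env_finite[OF escale_Gamma0[OF \<psi> l], of x] by auto
  have c: "conjugate g l = ereal (m - v)"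
    using opt unfolding phi_bar_eq_moreau_env[OF \<psi> l] m fin by (cases "conjugate g l") auto
  have "prox_obj 1 (escale l \<psi>) x w \<le> ereal v + ereal (m - v)"
    using prox_obj_escale_le_ecomp[OF \<psi> c, of x w] moreau_env_eq[OF w] fin by simp
  also have "\<dots> = moreau_env 1 (escale l \<psi>) x" by (simp add: m)
  also have "\<dots> \<le> prox_obj 1 (escale l \<psi>) x u" unfolding moreau_env_def by (rule INF_lower) simp
  finally show ?thesis .
qed

theorem proposition8:
  fixes g :: "real \<Rightarrow> ereal" and \<psi> :: "'a::euclidean_space \<Rightarrow> ereal" and x :: 'a
  assumes "g \<in> Gamma0" and "mono g" and "\<psi> \<in> Gamma0"
    and "ereal ` rel_interior (edom g) \<inter> \<psi> ` rel_interior (edom \<psi>) \<noteq> {}"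
  shows
    "let F = (\<lambda>l. conjugate g l + phi_bar \<psi> x l);
         A = argmin_on {0..} F;
         p = closest_point (closure (edom \<psi>)) x
     in
       moreau_env 1 (ecomp g \<psi>) x = - (INF l\<in>{0..}. F l)
     \<and> A \<noteq> {}
     \<and> ((\<exists>s t. g s \<noteq> g t) \<or> p \<in> edom \<psi> \<longrightarrow>
          (\<forall>l\<in>A. prox 1 (ecomp g \<psi>) x = prox 1 (escale l \<psi>) x))
     \<and> ((\<exists>s t. g s \<noteq> g t) \<or> p \<in> edom \<psi> \<longrightarrow>
          \<psi> p \<notin> ereal ` subdifferential (conjugate g) 0 \<longrightarrow> A \<subseteq> {0<..})
     \<and> (p \<notin> edom \<psi> \<longrightarrow>
          \<psi> p \<notin> ereal ` subdifferential (conjugate g) 0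
          \<and> ((\<exists>s t. g s \<noteq> g t) \<longrightarrow> A \<subseteq> {0<..}))"
proof -
  note g = assms(1) and mono = assms(2) and \<psi> = assms(3)
  define F where "F = (\<lambda>l. conjugate g l + phi_bar \<psi> x l)"
  define A where "A = argmin_on {0..} F"
  define p where "p = closest_point (closure (edom \<psi>)) x"
  let ?H = "prox_obj 1 (ecomp g \<psi>) x"
  let ?reg = "(\<exists>s t. g s \<noteq> g t) \<or> p \<in> edom \<psi>"
  obtain x0 s0 where s0: "\<psi> x0 = ereal s0" "s0 \<in> rel_interior (edom g)"
    using assms(4) by force
  then have "x0 \<in> edom (ecomp g \<psi>)"
    using rel_interior_subset[of "edom g"] by (auto simp: edom_def ecomp_def)
  then have dom: "edom (ecomp g \<psi>) \<noteq> {}" by blast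
  obtain v where v: "moreau_env 1 (ecomp g \<psi>) x = ereal v"
    using moreau_env_ecomp_finite[OF g mono \<psi> dom] by blast
  have weak: "ereal (- v) \<le> F l" if "0 \<le> l" for l
    using weak_duality[OF g \<psi> that, of x] by (simp add: v F_def)
  obtain l0 where l0: "0 \<le> l0" "F l0 \<le> ereal (- v)"
    using strong_duality[OF g mono \<psi> s0, of x] by (auto simp: v F_def)
  have inf: "(INF l\<in>{0..}. F l) = ereal (- v)"
    using weak l0 by (intro INF_eqI) (auto intro: order_trans)
  have A_iff: "l \<in> A \<longleftrightarrow> 0 \<le> l \<and> F l = ereal (- v)" for l
    using weak l0 by (auto simp: A_def argmin_on_iff intro: order_antisym order_trans)
  have min: "\<exists>w\<in>edom \<psi>. \<forall>u. ?H w \<le> ?H u" if ?reg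
    using ecomp_prox_obj_minimizer_exists[OF g mono \<psi> dom] that unfolding p_def by metis
  have transfer: "prox_obj 1 (escale l \<psi>) x w \<le> prox_obj 1 (escale l \<psi>) x u"
    if "l \<in> A" "\<And>u. ?H w \<le> ?H u" for l w u
    using dual_optimal_minimizer[OF \<psi> _ _ v, of l w] that by (simp add: A_iff F_def v)
  have unique: "w = w'"
    if "0 \<le> l" "\<And>u. prox_obj 1 (escale l \<psi>) x w \<le> prox_obj 1 (escale l \<psi>) x u"
      "\<And>u. prox_obj 1 (escale l \<psi>) x w' \<le> prox_obj 1 (escale l \<psi>) x u" for l w w'
    using prox_obj_minimizer_unique[OF escale_Gamma0[OF \<psi> that(1)] that(2,3)] .
  have b: "prox 1 (ecomp g \<psi>) x = prox 1 (escale l \<psi>) x" if ?reg and l: "l \<in> A" for l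
  proof -
    obtain w where w: "\<And>u. ?H w \<le> ?H u" using min[OF \<open>?reg\<close>] by blast
    have "0 \<le> l" using l by (simp add: A_iff)
    note min_w = transfer[OF l w]
    have "prox 1 (ecomp g \<psi>) x = w"
      by (rule prox_eqI[OF w]) (rule unique[OF \<open>0 \<le> l\<close> transfer[OF l] min_w])
    moreover have "prox 1 (escale l \<psi>) x = w"
      by (rule prox_eqI[OF min_w]) (rule unique[OF \<open>0 \<le> l\<close> _ min_w])
    ultimately show ?thesis by simp
  qed
  have c: "A \<subseteq> {0<..}" if ?reg and notin: "\<psi> p \<notin> ereal ` subdifferential (conjugate g) 0"
  proof (rule ccontr)
    assume "\<not> A \<subseteq> {0<..}"
    then have A0: "0 \<in> A" using A_iff by force
    obtain w where w: "w \<in> edom \<psi>" "\<And>u. ?H w \<le> ?H u" using min[OF \<open>?reg\<close>] by blast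
    have "w = p"
      unfolding p_def
      by (rule unique[OF order_refl transfer[OF A0 w(2)] closest_point_minimizes_escale_0[OF \<psi>]])
    then have p: "p \<in> edom \<psi>" using w(1) by simp
    define t where "t = real_of_ereal (\<psi> p)"
    have t: "\<psi> p = ereal t" using edom_finite[OF \<psi> p] by (simp add: t_def)
    have "ecomp g \<psi> p = g t" using p by (simp add: ecomp_def t_def)
    then have gt: "g t + ereal (1/2 * (norm (x - p))\<^sup>2) = ereal v"
      using moreau_env_eq[OF w(2)] \<open>w = p\<close> by (simp add: v prox_obj_1)
    have "moreau_env 1 (escale 0 \<psi>) x = ereal (1/2 * (norm (x - p))\<^sup>2)"
      using moreau_env_eq[OF closest_point_minimizes_escale_0[OF \<psi>], of x]
      by (simp add: prox_obj_1 escale_on_edom[OF \<psi> p] flip: p_def)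
    then have "conjugate g 0 - ereal (1/2 * (norm (x - p))\<^sup>2) = ereal (- v)"
      using A0 by (simp add: A_iff F_def phi_bar_eq_moreau_env[OF \<psi>] minus_ereal_def)
    with gt have eq: "conjugate g 0 = - g t" "\<bar>g t\<bar> \<noteq> \<infinity>"
      by (cases "g t"; cases "conjugate g 0"; auto)+
    have "conjugate g 0 + ereal (t \<bullet> (y - 0)) \<le> conjugate g y" for y
    proof -
      have "ereal (y \<bullet> t) - g t \<le> conjugate g y"
        unfolding conjugate_def by (rule SUP_upper) simp
      then show ?thesis using eq by (cases "g t") (auto simp: mult.commute)
    qed
    then have "t \<in> subdifferential (conjugate g) 0"
      using eq by (simp add: subdifferential_def)
    with notin t show False by auto
  qed
  have d: "\<psi> p \<notin> ereal ` subdifferential (conjugate g) 0" if "p \<notin> edom \<psi>"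
    using that by (auto simp: edom_def)
  have "moreau_env 1 (ecomp g \<psi>) x = - (INF l\<in>{0..}. F l)" by (simp add: inf v)
  moreover have "A \<noteq> {}" using l0 weak[OF l0(1)] A_iff by (metis empty_iff order_antisym)
  ultimately show ?thesis
    unfolding Let_def F_def[symmetric] A_def[symmetric] p_def[symmetric] using b c d by blast
qed

end
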